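(* Let $q\colon E\to M$ be a submersion in a tangent category $(\mathbb X,\mathbb T)$. There is a bijective correspondence between Ehresmann connections on $q$ and Ehresmann connection forms on $q$. Explicitly, if $(R,H)$ is an Ehresmann connection on $q$, then $(\phi_R,\psi_H)$ with $\phi_R:=R\iota_q$ and $\psi_H:=\pi_qH$ is an Ehresmann connection form on $q$. Conversely, if $(\phi,\psi)$ is an Ehresmann connection form on $q$, then $(R_\phi,H_\psi)$ is an Ehresmann connection on $q$, where $R_\phi\colon\mathbf p_E\to\mathbf q^V$ is the unique morphism of $\mathsf{DB}(E)$ with $R_\phi\iota_q=\phi$ and $R_\phi q^V=p_E$, and $H_\psi\colon\mathbf q^F\to\mathbf p_E$ is the unique morphism of $\mathsf{DB}(E)$ with $\pi_qH_\psi=\psi$ and $z_q^FH_\psi=z_E$.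
   Context: Composition is diagrammatic: $fg$ is $f$ followed by $g$; $\langle f,g\rangle$ denotes pairing into a (fibred) product, with projections $\pi_1,\pi_2$. A tangent category $(\mathbb X,\mathbb T)$ is a category $\mathbb X$ with an endofunctor $T$ and natural transformations $p_M\colon TM\to M$, $z_M\colon M\to TM$, $s_M\colon T_2M\to TM$, $l_M\colon TM\to T^2M$, $c_M\colon T^2M\to T^2M$, where the $n$-fold pullback $T_nM$ of $p_M$ along itself exists and is preserved by all $T^m$, such that: $(p_M,z_M,s_M)$ is an additive bundle (a commutative monoid in the category over $M$); $(z_M,l_M)\colon p_M\to Tp_M$ and $(\mathrm{id}_{TM},c_M)\colon Tp_M\to p_{TM}$ are additive bundle morphisms (commutative squares preserving zero and sum); $c_Mc_M=\mathrm{id}$, $l_Mc_M=l_M$, $l_M\,Tl_M=l_M\,l_{TM}$, $Tc_M\,c_{TM}\,Tc_M=c_{TM}\,Tc_M\,c_{TM}$, $l_{TM}\,Tc_M\,c_{TM}=c_M\,Tl_M$; and, with $\xi_M=\langle\pi_1l_M,\pi_2z_{TM}\rangle\,Ts_M\colon T_2M\to T^2M$, the square $\xi_M\,Tp_M=\pi_1p_Mz_M$ is a tangent pullback. A tangent pullback is a pullback preserved by $T^m$ for all $m\ge0$. A tangent display map is a morphism $q\colon E\to M$ such that for all $n\ge0$ and all $f\colon N\to T^nM$ the pullback of $T^nq$ along $f$ exists and is a tangent pullback. A differential bundle $\mathbf q\colon E\to M$ consists of $q\colon E\to M$, $z_q\colon M\to E$, $s_q\colon E_2\to E$, $l_q\colon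 E\to TE$ ($E_n$ the $n$-fold pullback of $q$ along itself, required to exist and be preserved by all $T^m$) such that $(q,z_q,s_q)$ is an additive bundle, $(z_M,l_q)\colon q\to Tq$ and $(z_q,l_q)\colon q\to p_E$ are additive bundle morphisms, $l_ql_E=l_q\,Tl_q$, and with $\xi_q=\langle\pi_1l_q,\pi_2z_E\rangle\,Ts_q\colon E_2\to TE$ the square $\xi_q\,Tq=\pi_1qz_M$ is a tangent pullback. Convention: all differential bundles are assumed display, i.e. $q$ is a tangent display map. A morphism $(f,g)\colon\mathbf q\to\mathbf q'$ (with $qf=gq'$) is linear if $g\,l_{q'}=l_q\,Tg$. $\mathsf{DB}(E)$ is the category of differential bundles over $E$ and linear morphisms over $\mathrm{id}_E$; it has finite biproducts, with zero object the trivial bundle $\mathbf 0_E=(\mathrm{id}_E,\mathrm{id}_E,\mathrm{id}_E,z_E)$. $\mathbf p_E=(p_E,z_E,s_E,l_E)$ is the tangent bundle. For a tangent display map $q\colon E\to M$: the vertical bundle $\mathbf q^V\colon Vq\to E$ is given by the tangent pullback $Vq$ of $Tq$ along $z_M$, with projections $\iota_q\colon Vq\to TE$ and $T^Vq\colon Vq\to M$; $q^V=\iota_qp_E$, and its zero $z_q^V$, sum $s^V_q$, lift $l_q^V$ are determined by $z_q^V\iota_q=z_E$, $s_q^V\iota_q=(\iota_q\times\iota_q)s_E$, $l_q^V\,T\iota_q=\iota_ql_E$. The Finsler bundle $\mathbf q^F\colon Fq\to E$ is given by the tangent pullback $Fq$ of $q$ along $p_M$, with projections $q^F\colon Fq\to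 E$ and $T^Fq\colon Fq\to TM$, its zero $z_q^F$, sum $s_q^F$, lift $l_q^F$ determined by $z_q^Fq^F=\mathrm{id}_E$, $z_q^F\,T^Fq=qz_M$; $s_q^Fq^F=\pi_1q^F$, $s_q^F\,T^Fq=(T^Fq\times T^Fq)s_M$; $l_q^F\,Tq^F=q^Fz_E$, $l_q^F\,T(T^Fq)=T^Fq\,l_M$. The horizontal descent $\pi_q\colon TE\to Fq$ is the unique morphism with $\pi_qq^F=p_E$ and $\pi_q\,T^Fq=Tq$. The square $\iota_q\pi_q=q^Vz_q^F$ (with corners $\mathbf q^V,\mathbf p_E,\mathbf 0_E,\mathbf q^F$) is commutative in $\mathsf{DB}(E)$; $q$ is a submersion if it is a pushout in $\mathsf{DB}(E)$. A vertical connection on $q$ is $R\colon TE\to Vq$ with $\iota_qR=\mathrm{id}_{Vq}$ and $R\colon\mathbf p_E\to\mathbf q^V$ linear over $E$ ($Rq^V=p_E$, $Rl_q^V=l_E\,TR$). A horizontal connection on $q$ is $H\colon Fq\to TE$ with $H\pi_q=\mathrm{id}_{Fq}$ and $H\colon\mathbf q^F\to\mathbf p_E$ linear over $E$ ($Hp_E=q^F$, $Hl_E=l_q^F\,TH$). An Ehresmann connection on $q$ is a pair $(R,H)$ of a vertical and a horizontal connection with $HR=q^Fz_q^V$ and $\langle R\iota_q,\pi_qH\rangle s_E=\mathrm{id}_{TE}$. A vertical connection form on $q$ is $\phi\colon TE\to TE$ with $\iota_q\phi=\iota_q$, $\phi\colon\mathbf p_E\to\mathbf p_E$ linear over $E$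 ($\phi p_E=p_E$, $\phi l_E=l_E\,T\phi$), and $\phi\,Tq=p_E\,q\,z_M$. A horizontal connection form on $q$ is $\psi\colon TE\to TE$ with $\psi\pi_q=\pi_q$, $\psi\colon\mathbf p_E\to\mathbf p_E$ linear over $E$, and $\iota_q\psi=q^Vz_E$. An Ehresmann connection form on $q$ is a pair $(\phi,\psi)$ of a vertical connection form and a horizontal connection form with $\psi\phi=p_Ez_E$ and $\langle\phi,\psi\rangle s_E=\mathrm{id}_{TE}$. *)

theory Defs
  imports Main
begin

record ('o, 'm) category =
  Obj :: "'o set"
  Arr :: "'m set"
  Dom :: "'m \<Rightarrow> 'o"
  Cod :: "'m \<Rightarrow> 'o"
  Ide :: "'o \<Rightarrow> 'm"
  Comp :: "'m \<Rightarrow> 'm \<Rightarrow> 'm"  (infixl "\<cdot>\<index>" 70)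

(* Composition is diagrammatic: f \<cdot> g is f followed by g.  All operations are total functions
   that are meaningful only on objects, arrows and composable pairs, respectively. *)

definition hom :: "('o, 'm, 'x) category_scheme \<Rightarrow> 'o \<Rightarrow> 'o \<Rightarrow> 'm set" where
  "hom C A B = {f \<in> Arr C. Dom C f = A \<and> Cod C f = B}"

definition is_category :: "('o, 'm, 'x) category_scheme \<Rightarrow> bool" where
  "is_category C \<longleftrightarrow>
     (\<forall>f\<in>Arr C. Dom C f \<in> Obj C \<and> Cod C f \<in> Obj C) \<and>
     (\<forall>A\<in>Obj C. Ide C A \<in> hom C A A) \<and>
     (\<forall>f\<in>Arr C. \<forall>g\<in>Arr C. Cod C f = Dom C g \<longrightarrow> f \<cdot>\<^bsub>C\<^esub> g \<in> hom C (Dom C f) (Cod C g)) \<and>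
     (\<forall>f\<in>Arr C. Ide C (Dom C f) \<cdot>\<^bsub>C\<^esub> f = f \<and> f \<cdot>\<^bsub>C\<^esub> Ide C (Cod C f) = f) \<and>
     (\<forall>f\<in>Arr C. \<forall>g\<in>Arr C. \<forall>h\<in>Arr C. Cod C f = Dom C g \<and> Cod C g = Dom C h \<longrightarrow>
        (f \<cdot>\<^bsub>C\<^esub> g) \<cdot>\<^bsub>C\<^esub> h = f \<cdot>\<^bsub>C\<^esub> (g \<cdot>\<^bsub>C\<^esub> h))"

(* (u, v) is a pullback of f along g, the square being u f = v g. *)
definition is_pullback :: "('o, 'm, 'x) category_scheme \<Rightarrow> 'm \<Rightarrow> 'm \<Rightarrow> 'm \<Rightarrow> 'm \<Rightarrow> bool" where
  "is_pullback C f g u v \<longleftrightarrow>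
     f \<in> Arr C \<and> g \<in> Arr C \<and> u \<in> Arr C \<and> v \<in> Arr C \<and>
     Cod C f = Cod C g \<and> Dom C u = Dom C v \<and> Cod C u = Dom C f \<and> Cod C v = Dom C g \<and>
     u \<cdot>\<^bsub>C\<^esub> f = v \<cdot>\<^bsub>C\<^esub> g \<and>
     (\<forall>A. \<forall>a\<in>hom C A (Dom C f). \<forall>b\<in>hom C A (Dom C g). a \<cdot>\<^bsub>C\<^esub> f = b \<cdot>\<^bsub>C\<^esub> g \<longrightarrow>
        (\<exists>!h. h \<in> hom C A (Dom C u) \<and> h \<cdot>\<^bsub>C\<^esub> u = a \<and> h \<cdot>\<^bsub>C\<^esub> v = b))"

(* (u, v) is a pushout of (f, g), the square being f u = g v. *)
definition is_pushout :: "('o, 'm, 'x) category_scheme \<Rightarrow> 'm \<Rightarrow> 'm \<Rightarrow> 'm \<Rightarrow> 'm \<Rightarrow> bool" where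
  "is_pushout C f g u v \<longleftrightarrow>
     f \<in> Arr C \<and> g \<in> Arr C \<and> u \<in> Arr C \<and> v \<in> Arr C \<and>
     Dom C f = Dom C g \<and> Cod C u = Cod C v \<and> Cod C f = Dom C u \<and> Cod C g = Dom C v \<and>
     f \<cdot>\<^bsub>C\<^esub> u = g \<cdot>\<^bsub>C\<^esub> v \<and>
     (\<forall>A. \<forall>a\<in>hom C (Cod C f) A. \<forall>b\<in>hom C (Cod C g) A. f \<cdot>\<^bsub>C\<^esub> a = g \<cdot>\<^bsub>C\<^esub> b \<longrightarrow>
        (\<exists>!h. h \<in> hom C (Cod C u) A \<and> u \<cdot>\<^bsub>C\<^esub> h = a \<and> v \<cdot>\<^bsub>C\<^esub> h = b))"

(* The n-fold pullback of q along itself: the product of n copies of q in the slice over Cod q,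
   with structure map r to the base (so that the case n = 0 is the base itself) and
   projections \<pi> i for i < n. *)
definition is_nfold_pullback ::
    "('o, 'm, 'x) category_scheme \<Rightarrow> 'm \<Rightarrow> nat \<Rightarrow> 'm \<Rightarrow> (nat \<Rightarrow> 'm) \<Rightarrow> bool" where
  "is_nfold_pullback C q n r \<pi> \<longleftrightarrow>
     q \<in> Arr C \<and> r \<in> Arr C \<and> Cod C r = Cod C q \<and>
     (\<forall>i<n. \<pi> i \<in> hom C (Dom C r) (Dom C q) \<and> \<pi> i \<cdot>\<^bsub>C\<^esub> q = r) \<and>
     (\<forall>A a f. a \<in> hom C A (Cod C q) \<and> (\<forall>i<n. f i \<in> hom C A (Dom C q) \<and> f i \<cdot>\<^bsub>C\<^esub> q = a) \<longrightarrow>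
        (\<exists>!h. h \<in> hom C A (Dom C r) \<and> h \<cdot>\<^bsub>C\<^esub> r = a \<and> (\<forall>i<n. h \<cdot>\<^bsub>C\<^esub> \<pi> i = f i)))"

(* The pairing of a and b into a (fibred) product with projections u and v. *)
definition pair :: "('o, 'm, 'x) category_scheme \<Rightarrow> 'm \<Rightarrow> 'm \<Rightarrow> 'm \<Rightarrow> 'm \<Rightarrow> 'm" where
  "pair C u v a b = (THE h. h \<in> hom C (Dom C a) (Dom C u) \<and> h \<cdot>\<^bsub>C\<^esub> u = a \<and> h \<cdot>\<^bsub>C\<^esub> v = b)"

(* The domain of the sum is the 2-fold pullback of the projection along itself; its chosen
   limit projections bpr1 and bpr2 are part of the data. *)
record 'm additive_bundle =
  bproj :: 'm
  bzero :: 'm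
  bpr1 :: 'm
  bpr2 :: 'm
  bsum :: 'm

record 'm differential_bundle = "'m additive_bundle" +
  blift :: 'm

abbreviation btot :: "('o, 'm, 'x) category_scheme \<Rightarrow> ('m, 'y) additive_bundle_scheme \<Rightarrow> 'o" where
  "btot C B \<equiv> Dom C (bproj B)"

abbreviation bbase :: "('o, 'm, 'x) category_scheme \<Rightarrow> ('m, 'y) additive_bundle_scheme \<Rightarrow> 'o" where
  "bbase C B \<equiv> Cod C (bproj B)"

abbreviation bpair ::
    "('o, 'm, 'x) category_scheme \<Rightarrow> ('m, 'y) additive_bundle_scheme \<Rightarrow> 'm \<Rightarrow> 'm \<Rightarrow> 'm" where
  "bpair C B \<equiv> pair C (bpr1 B) (bpr2 B)"

(* A commutative monoid in the slice over the base.  Associativity is expressed on all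
   generalized elements; on the universal one it is the usual diagram on the 3-fold pullback. *)
definition is_additive_bundle ::
    "('o, 'm, 'x) category_scheme \<Rightarrow> ('m, 'y) additive_bundle_scheme \<Rightarrow> bool" where
  "is_additive_bundle C B \<longleftrightarrow>
     (let q = bproj B; z = bzero B; \<pi>1 = bpr1 B; \<pi>2 = bpr2 B; s = bsum B; E = btot C B; M = bbase C B in
        is_pullback C q q \<pi>1 \<pi>2 \<and>
        z \<in> hom C M E \<and> z \<cdot>\<^bsub>C\<^esub> q = Ide C M \<and>
        s \<in> hom C (Dom C \<pi>1) E \<and> s \<cdot>\<^bsub>C\<^esub> q = \<pi>1 \<cdot>\<^bsub>C\<^esub> q \<and>
        bpair C B (Ide C E) (q \<cdot>\<^bsub>C\<^esub> z) \<cdot>\<^bsub>C\<^esub> s = Ide C E \<and>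
        bpair C B \<pi>2 \<pi>1 \<cdot>\<^bsub>C\<^esub> s = s \<and>
        (\<forall>A. \<forall>f\<in>hom C A E. \<forall>g\<in>hom C A E. \<forall>h\<in>hom C A E.
           f \<cdot>\<^bsub>C\<^esub> q = g \<cdot>\<^bsub>C\<^esub> q \<and> g \<cdot>\<^bsub>C\<^esub> q = h \<cdot>\<^bsub>C\<^esub> q \<longrightarrow>
             bpair C B (bpair C B f g \<cdot>\<^bsub>C\<^esub> s) h \<cdot>\<^bsub>C\<^esub> s =
             bpair C B f (bpair C B g h \<cdot>\<^bsub>C\<^esub> s) \<cdot>\<^bsub>C\<^esub> s))"

definition is_additive_bundle_morphism ::
    "('o, 'm, 'x) category_scheme \<Rightarrow> ('m, 'y) additive_bundle_scheme \<Rightarrow>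
     ('m, 'z) additive_bundle_scheme \<Rightarrow> 'm \<Rightarrow> 'm \<Rightarrow> bool" where
  "is_additive_bundle_morphism C B B' f g \<longleftrightarrow>
     f \<in> hom C (bbase C B) (bbase C B') \<and> g \<in> hom C (btot C B) (btot C B') \<and>
     bproj B \<cdot>\<^bsub>C\<^esub> f = g \<cdot>\<^bsub>C\<^esub> bproj B' \<and>
     bzero B \<cdot>\<^bsub>C\<^esub> g = f \<cdot>\<^bsub>C\<^esub> bzero B' \<and>
     bsum B \<cdot>\<^bsub>C\<^esub> g = bpair C B' (bpr1 B \<cdot>\<^bsub>C\<^esub> g) (bpr2 B \<cdot>\<^bsub>C\<^esub> g) \<cdot>\<^bsub>C\<^esub> bsum B'"

(* tpr1 X M and tpr2 X M are the projections of the chosen pullback T2 M, the domain of tsum X M. *)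
record ('o, 'm) tangent_structure = "('o, 'm) category" +
  Tobj :: "'o \<Rightarrow> 'o"
  Tarr :: "'m \<Rightarrow> 'm"
  tproj :: "'o \<Rightarrow> 'm"
  tzero :: "'o \<Rightarrow> 'm"
  tpr1 :: "'o \<Rightarrow> 'm"
  tpr2 :: "'o \<Rightarrow> 'm"
  tsum :: "'o \<Rightarrow> 'm"
  tlift :: "'o \<Rightarrow> 'm"
  tflip :: "'o \<Rightarrow> 'm"

definition is_tangent_pullback ::
    "('o, 'm, 'x) tangent_structure_scheme \<Rightarrow> 'm \<Rightarrow> 'm \<Rightarrow> 'm \<Rightarrow> 'm \<Rightarrow> bool" where
  "is_tangent_pullback X f g u v \<longleftrightarrow>
     (\<forall>m. is_pullback X ((Tarr X ^^ m) f) ((Tarr X ^^ m) g) ((Tarr X ^^ m) u) ((Tarr X ^^ m) v))"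

definition has_tangent_nfold_pullbacks :: "('o, 'm, 'x) tangent_structure_scheme \<Rightarrow> 'm \<Rightarrow> bool" where
  "has_tangent_nfold_pullbacks X q \<longleftrightarrow>
     (\<forall>n. \<exists>r \<pi>. \<forall>m.
        is_nfold_pullback X ((Tarr X ^^ m) q) n ((Tarr X ^^ m) r) (\<lambda>i. (Tarr X ^^ m) (\<pi> i)))"

definition tangent_bundle :: "('o, 'm, 'x) tangent_structure_scheme \<Rightarrow> 'o \<Rightarrow> 'm differential_bundle" where
  "tangent_bundle X M =
     \<lparr>bproj = tproj X M, bzero = tzero X M, bpr1 = tpr1 X M, bpr2 = tpr2 X M,
      bsum = tsum X M, blift = tlift X M\<rparr>"

abbreviation tpair :: "('o, 'm, 'x) tangent_structure_scheme \<Rightarrow> 'o \<Rightarrow> 'm \<Rightarrow> 'm \<Rightarrow> 'm" where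
  "tpair X M \<equiv> pair X (tpr1 X M) (tpr2 X M)"

(* The image of an additive bundle under T. *)
definition T_bundle ::
    "('o, 'm, 'x) tangent_structure_scheme \<Rightarrow> ('m, 'y) additive_bundle_scheme \<Rightarrow> 'm additive_bundle" where
  "T_bundle X B =
     \<lparr>bproj = Tarr X (bproj B), bzero = Tarr X (bzero B), bpr1 = Tarr X (bpr1 B),
      bpr2 = Tarr X (bpr2 B), bsum = Tarr X (bsum B)\<rparr>"

(* The map xi = <pi1 l, pi2 z> T(s) from the 2-fold pullback to the tangent object of the total space. *)
definition vertical_comparison ::
    "('o, 'm, 'x) tangent_structure_scheme \<Rightarrow> 'm differential_bundle \<Rightarrow> 'm" where
  "vertical_comparison X B =
     bpair X (T_bundle X B) (bpr1 B \<cdot>\<^bsub>X\<^esub> blift B) (bpr2 B \<cdot>\<^bsub>X\<^esub> tzero X (btot X B))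
       \<cdot>\<^bsub>X\<^esub> Tarr X (bsum B)"

definition is_endofunctor :: "('o, 'm, 'x) tangent_structure_scheme \<Rightarrow> bool" where
  "is_endofunctor X \<longleftrightarrow>
     (\<forall>A\<in>Obj X. Tobj X A \<in> Obj X \<and> Tarr X (Ide X A) = Ide X (Tobj X A)) \<and>
     (\<forall>f\<in>Arr X. Tarr X f \<in> hom X (Tobj X (Dom X f)) (Tobj X (Cod X f))) \<and>
     (\<forall>f\<in>Arr X. \<forall>g\<in>Arr X. Cod X f = Dom X g \<longrightarrow>
        Tarr X (f \<cdot>\<^bsub>X\<^esub> g) = Tarr X f \<cdot>\<^bsub>X\<^esub> Tarr X g)"

definition is_tangent_category :: "('o, 'm, 'x) tangent_structure_scheme \<Rightarrow> bool" where
  "is_tangent_category X \<longleftrightarrow>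
     is_category X \<and> is_endofunctor X \<and>
     (\<forall>M\<in>Obj X.
        tproj X M \<in> hom X (Tobj X M) M \<and>
        tzero X M \<in> hom X M (Tobj X M) \<and>
        tsum X M \<in> hom X (Dom X (tpr1 X M)) (Tobj X M) \<and>
        tlift X M \<in> hom X (Tobj X M) (Tobj X (Tobj X M)) \<and>
        tflip X M \<in> hom X (Tobj X (Tobj X M)) (Tobj X (Tobj X M))) \<and>
     (\<forall>f\<in>Arr X. \<forall>M N. M = Dom X f \<and> N = Cod X f \<longrightarrow>
        Tarr X f \<cdot>\<^bsub>X\<^esub> tproj X N = tproj X M \<cdot>\<^bsub>X\<^esub> f \<and>
        f \<cdot>\<^bsub>X\<^esub> tzero X N = tzero X M \<cdot>\<^bsub>X\<^esub> Tarr X f \<and>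
        tpair X N (tpr1 X M \<cdot>\<^bsub>X\<^esub> Tarr X f) (tpr2 X M \<cdot>\<^bsub>X\<^esub> Tarr X f) \<cdot>\<^bsub>X\<^esub> tsum X N =
          tsum X M \<cdot>\<^bsub>X\<^esub> Tarr X f \<and>
        Tarr X f \<cdot>\<^bsub>X\<^esub> tlift X N = tlift X M \<cdot>\<^bsub>X\<^esub> Tarr X (Tarr X f) \<and>
        Tarr X (Tarr X f) \<cdot>\<^bsub>X\<^esub> tflip X N = tflip X M \<cdot>\<^bsub>X\<^esub> Tarr X (Tarr X f)) \<and>
     (\<forall>M\<in>Obj X.
        has_tangent_nfold_pullbacks X (tproj X M) \<and>
        is_tangent_pullback X (tproj X M) (tproj X M) (tpr1 X M) (tpr2 X M) \<and>
        is_additive_bundle X (tangent_bundle X M) \<and>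
        is_additive_bundle_morphism X (tangent_bundle X M) (T_bundle X (tangent_bundle X M))
          (tzero X M) (tlift X M) \<and>
        is_additive_bundle_morphism X (T_bundle X (tangent_bundle X M)) (tangent_bundle X (Tobj X M))
          (Ide X (Tobj X M)) (tflip X M) \<and>
        tflip X M \<cdot>\<^bsub>X\<^esub> tflip X M = Ide X (Tobj X (Tobj X M)) \<and>
        tlift X M \<cdot>\<^bsub>X\<^esub> tflip X M = tlift X M \<and>
        tlift X M \<cdot>\<^bsub>X\<^esub> Tarr X (tlift X M) = tlift X M \<cdot>\<^bsub>X\<^esub> tlift X (Tobj X M) \<and>
        Tarr X (tflip X M) \<cdot>\<^bsub>X\<^esub> tflip X (Tobj X M) \<cdot>\<^bsub>X\<^esub> Tarr X (tflip X M) =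
          tflip X (Tobj X M) \<cdot>\<^bsub>X\<^esub> Tarr X (tflip X M) \<cdot>\<^bsub>X\<^esub> tflip X (Tobj X M) \<and>
        tlift X (Tobj X M) \<cdot>\<^bsub>X\<^esub> Tarr X (tflip X M) \<cdot>\<^bsub>X\<^esub> tflip X (Tobj X M) =
          tflip X M \<cdot>\<^bsub>X\<^esub> Tarr X (tlift X M) \<and>
        is_tangent_pullback X (Tarr X (tproj X M)) (tzero X M)
          (vertical_comparison X (tangent_bundle X M)) (tpr1 X M \<cdot>\<^bsub>X\<^esub> tproj X M))"

definition is_tangent_display_map :: "('o, 'm, 'x) tangent_structure_scheme \<Rightarrow> 'm \<Rightarrow> bool" where
  "is_tangent_display_map X q \<longleftrightarrow>
     q \<in> Arr X \<and>
     (\<forall>n. \<forall>f\<in>Arr X. Cod X f = (Tobj X ^^ n) (Cod X q) \<longrightarrow>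
        (\<exists>u v. is_tangent_pullback X ((Tarr X ^^ n) q) f u v))"

(* As is conventional here, a differential bundle is always display. *)
definition is_differential_bundle ::
    "('o, 'm, 'x) tangent_structure_scheme \<Rightarrow> 'm differential_bundle \<Rightarrow> bool" where
  "is_differential_bundle X B \<longleftrightarrow>
     (let q = bproj B; E = btot X B; M = bbase X B; l = blift B in
        is_tangent_display_map X q \<and>
        has_tangent_nfold_pullbacks X q \<and>
        is_tangent_pullback X q q (bpr1 B) (bpr2 B) \<and>
        is_additive_bundle X B \<and>
        is_additive_bundle_morphism X B (T_bundle X B) (tzero X M) l \<and>
        is_additive_bundle_morphism X B (tangent_bundle X E) (bzero B) l \<and>
        l \<cdot>\<^bsub>X\<^esub> tlift X E = l \<cdot>\<^bsub>X\<^esub> Tarr X l \<and>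
        is_tangent_pullback X (Tarr X q) (tzero X M) (vertical_comparison X B) (bpr1 B \<cdot>\<^bsub>X\<^esub> q))"

definition is_linear_morphism ::
    "('o, 'm, 'x) tangent_structure_scheme \<Rightarrow> 'm differential_bundle \<Rightarrow> 'm differential_bundle \<Rightarrow>
     'm \<Rightarrow> 'm \<Rightarrow> bool" where
  "is_linear_morphism X B B' f g \<longleftrightarrow>
     f \<in> hom X (bbase X B) (bbase X B') \<and> g \<in> hom X (btot X B) (btot X B') \<and>
     bproj B \<cdot>\<^bsub>X\<^esub> f = g \<cdot>\<^bsub>X\<^esub> bproj B' \<and>
     g \<cdot>\<^bsub>X\<^esub> blift B' = blift B \<cdot>\<^bsub>X\<^esub> Tarr X g"

(* Arrows of DB(E) are triples consisting of source, underlying map of total spaces, and target. *)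
definition DB ::
    "('o, 'm, 'x) tangent_structure_scheme \<Rightarrow> 'o \<Rightarrow>
     ('m differential_bundle, 'm differential_bundle \<times> 'm \<times> 'm differential_bundle) category" where
  "DB X E =
     \<lparr>Obj = {B. is_differential_bundle X B \<and> bbase X B = E},
      Arr = {(B, f, B'). is_differential_bundle X B \<and> bbase X B = E \<and>
                         is_differential_bundle X B' \<and> bbase X B' = E \<and>
                         is_linear_morphism X B B' (Ide X E) f},
      Dom = (\<lambda>(B, f, B'). B),
      Cod = (\<lambda>(B, f, B'). B'),
      Ide = (\<lambda>B. (B, Ide X (btot X B), B)),
      Comp = (\<lambda>(B, f, _) (_, g, B'). (B, f \<cdot>\<^bsub>X\<^esub> g, B'))\<rparr>"

definition trivial_bundle :: "('o, 'm, 'x) tangent_structure_scheme \<Rightarrow> 'o \<Rightarrow> 'm differential_bundle" where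
  "trivial_bundle X E =
     \<lparr>bproj = Ide X E, bzero = Ide X E, bpr1 = Ide X E, bpr2 = Ide X E, bsum = Ide X E,
      blift = tzero X E\<rparr>"

(* Pullbacks exist but are not canonical, so the vertical and the Finsler bundle are given by
   predicates on a choice of the defining pullback (\<iota> and tV, resp. bproj F and tF) and of the
   2-fold pullback of the projection; every choice is allowed.  The maps \<iota>, tV and tF are
   written iota_q, T^V q and T^F q in the literature. *)
definition is_vertical_bundle ::
    "('o, 'm, 'x) tangent_structure_scheme \<Rightarrow> 'm \<Rightarrow> 'm \<Rightarrow> 'm \<Rightarrow> 'm differential_bundle \<Rightarrow> bool" where
  "is_vertical_bundle X q \<iota> tV V \<longleftrightarrow>
     (let E = Dom X q; M = Cod X q in
        is_tangent_pullback X (Tarr X q) (tzero X M) \<iota> tV \<and>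
        bproj V = \<iota> \<cdot>\<^bsub>X\<^esub> tproj X E \<and>
        is_tangent_pullback X (bproj V) (bproj V) (bpr1 V) (bpr2 V) \<and>
        bzero V \<in> hom X E (Dom X \<iota>) \<and>
        bzero V \<cdot>\<^bsub>X\<^esub> \<iota> = tzero X E \<and>
        bsum V \<in> hom X (Dom X (bpr1 V)) (Dom X \<iota>) \<and>
        bsum V \<cdot>\<^bsub>X\<^esub> \<iota> = tpair X E (bpr1 V \<cdot>\<^bsub>X\<^esub> \<iota>) (bpr2 V \<cdot>\<^bsub>X\<^esub> \<iota>) \<cdot>\<^bsub>X\<^esub> tsum X E \<and>
        blift V \<in> hom X (Dom X \<iota>) (Tobj X (Dom X \<iota>)) \<and>
        blift V \<cdot>\<^bsub>X\<^esub> Tarr X \<iota> = \<iota> \<cdot>\<^bsub>X\<^esub> tlift X E)"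

definition is_Finsler_bundle ::
    "('o, 'm, 'x) tangent_structure_scheme \<Rightarrow> 'm \<Rightarrow> 'm \<Rightarrow> 'm differential_bundle \<Rightarrow> bool" where
  "is_Finsler_bundle X q tF F \<longleftrightarrow>
     (let E = Dom X q; M = Cod X q in
        is_tangent_pullback X q (tproj X M) (bproj F) tF \<and>
        is_tangent_pullback X (bproj F) (bproj F) (bpr1 F) (bpr2 F) \<and>
        bzero F \<in> hom X E (btot X F) \<and>
        bzero F \<cdot>\<^bsub>X\<^esub> bproj F = Ide X E \<and>
        bzero F \<cdot>\<^bsub>X\<^esub> tF = q \<cdot>\<^bsub>X\<^esub> tzero X M \<and>
        bsum F \<in> hom X (Dom X (bpr1 F)) (btot X F) \<and>
        bsum F \<cdot>\<^bsub>X\<^esub> bproj F = bpr1 F \<cdot>\<^bsub>X\<^esub> bproj F \<and>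
        bsum F \<cdot>\<^bsub>X\<^esub> tF = tpair X M (bpr1 F \<cdot>\<^bsub>X\<^esub> tF) (bpr2 F \<cdot>\<^bsub>X\<^esub> tF) \<cdot>\<^bsub>X\<^esub> tsum X M \<and>
        blift F \<in> hom X (btot X F) (Tobj X (btot X F)) \<and>
        blift F \<cdot>\<^bsub>X\<^esub> Tarr X (bproj F) = bproj F \<cdot>\<^bsub>X\<^esub> tzero X E \<and>
        blift F \<cdot>\<^bsub>X\<^esub> Tarr X tF = tF \<cdot>\<^bsub>X\<^esub> tlift X M)"

definition horizontal_descent ::
    "('o, 'm, 'x) tangent_structure_scheme \<Rightarrow> 'm \<Rightarrow> 'm \<Rightarrow> 'm differential_bundle \<Rightarrow> 'm" where
  "horizontal_descent X q tF F = pair X (bproj F) tF (tproj X (Dom X q)) (Tarr X q)"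

definition is_submersion ::
    "('o, 'm, 'x) tangent_structure_scheme \<Rightarrow> 'm \<Rightarrow> 'm \<Rightarrow> 'm differential_bundle \<Rightarrow>
     'm \<Rightarrow> 'm differential_bundle \<Rightarrow> bool" where
  "is_submersion X q \<iota> V tF F \<longleftrightarrow>
     is_tangent_display_map X q \<and>
     (let E = Dom X q in
        is_pushout (DB X E)
          (V, \<iota>, tangent_bundle X E)
          (V, bproj V, trivial_bundle X E)
          (tangent_bundle X E, horizontal_descent X q tF F, F)
          (trivial_bundle X E, bzero F, F))"

definition is_vertical_connection ::
    "('o, 'm, 'x) tangent_structure_scheme \<Rightarrow> 'm \<Rightarrow> 'm \<Rightarrow> 'm differential_bundle \<Rightarrow> 'm \<Rightarrow> bool" where
  "is_vertical_connection X q \<iota> V R \<longleftrightarrow>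
     (let E = Dom X q in
        is_linear_morphism X (tangent_bundle X E) V (Ide X E) R \<and>
        \<iota> \<cdot>\<^bsub>X\<^esub> R = Ide X (btot X V))"

definition is_horizontal_connection ::
    "('o, 'm, 'x) tangent_structure_scheme \<Rightarrow> 'm \<Rightarrow> 'm \<Rightarrow> 'm differential_bundle \<Rightarrow> 'm \<Rightarrow> bool" where
  "is_horizontal_connection X q tF F H \<longleftrightarrow>
     (let E = Dom X q in
        is_linear_morphism X F (tangent_bundle X E) (Ide X E) H \<and>
        H \<cdot>\<^bsub>X\<^esub> horizontal_descent X q tF F = Ide X (btot X F))"

definition Ehresmann_connections ::
    "('o, 'm, 'x) tangent_structure_scheme \<Rightarrow> 'm \<Rightarrow> 'm \<Rightarrow> 'm differential_bundle \<Rightarrow>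
     'm \<Rightarrow> 'm differential_bundle \<Rightarrow> ('m \<times> 'm) set" where
  "Ehresmann_connections X q \<iota> V tF F =
     {(R, H). is_vertical_connection X q \<iota> V R \<and> is_horizontal_connection X q tF F H \<and>
        H \<cdot>\<^bsub>X\<^esub> R = bproj F \<cdot>\<^bsub>X\<^esub> bzero V \<and>
        tpair X (Dom X q) (R \<cdot>\<^bsub>X\<^esub> \<iota>) (horizontal_descent X q tF F \<cdot>\<^bsub>X\<^esub> H) \<cdot>\<^bsub>X\<^esub> tsum X (Dom X q) =
          Ide X (Tobj X (Dom X q))}"

definition is_vertical_connection_form ::
    "('o, 'm, 'x) tangent_structure_scheme \<Rightarrow> 'm \<Rightarrow> 'm \<Rightarrow> 'm \<Rightarrow> bool" where
  "is_vertical_connection_form X q \<iota> \<phi> \<longleftrightarrow>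
     (let E = Dom X q; M = Cod X q in
        is_linear_morphism X (tangent_bundle X E) (tangent_bundle X E) (Ide X E) \<phi> \<and>
        \<iota> \<cdot>\<^bsub>X\<^esub> \<phi> = \<iota> \<and>
        \<phi> \<cdot>\<^bsub>X\<^esub> Tarr X q = tproj X E \<cdot>\<^bsub>X\<^esub> q \<cdot>\<^bsub>X\<^esub> tzero X M)"

definition is_horizontal_connection_form ::
    "('o, 'm, 'x) tangent_structure_scheme \<Rightarrow> 'm \<Rightarrow> 'm \<Rightarrow> 'm differential_bundle \<Rightarrow>
     'm \<Rightarrow> 'm differential_bundle \<Rightarrow> 'm \<Rightarrow> bool" where
  "is_horizontal_connection_form X q \<iota> V tF F \<psi> \<longleftrightarrow>
     (let E = Dom X q in
        is_linear_morphism X (tangent_bundle X E) (tangent_bundle X E) (Ide X E) \<psi> \<and>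
        \<psi> \<cdot>\<^bsub>X\<^esub> horizontal_descent X q tF F = horizontal_descent X q tF F \<and>
        \<iota> \<cdot>\<^bsub>X\<^esub> \<psi> = bproj V \<cdot>\<^bsub>X\<^esub> tzero X E)"

definition Ehresmann_connection_forms ::
    "('o, 'm, 'x) tangent_structure_scheme \<Rightarrow> 'm \<Rightarrow> 'm \<Rightarrow> 'm differential_bundle \<Rightarrow>
     'm \<Rightarrow> 'm differential_bundle \<Rightarrow> ('m \<times> 'm) set" where
  "Ehresmann_connection_forms X q \<iota> V tF F =
     {(\<phi>, \<psi>). is_vertical_connection_form X q \<iota> \<phi> \<and> is_horizontal_connection_form X q \<iota> V tF F \<psi> \<and>
        \<psi> \<cdot>\<^bsub>X\<^esub> \<phi> = tproj X (Dom X q) \<cdot>\<^bsub>X\<^esub> tzero X (Dom X q) \<and>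
        tpair X (Dom X q) \<phi> \<psi> \<cdot>\<^bsub>X\<^esub> tsum X (Dom X q) = Ide X (Tobj X (Dom X q))}"

(* The maps R_phi and H_psi are obtained by definite description from the following two predicates. *)
definition induces_vertical ::
    "('o, 'm, 'x) tangent_structure_scheme \<Rightarrow> 'm \<Rightarrow> 'm \<Rightarrow> 'm differential_bundle \<Rightarrow> 'm \<Rightarrow> 'm \<Rightarrow> bool" where
  "induces_vertical X q \<iota> V \<phi> R \<longleftrightarrow>
     (let E = Dom X q in
        (tangent_bundle X E, R, V) \<in> Arr (DB X E) \<and>
        R \<cdot>\<^bsub>X\<^esub> \<iota> = \<phi> \<and> R \<cdot>\<^bsub>X\<^esub> bproj V = tproj X E)"

definition induces_horizontal ::
    "('o, 'm, 'x) tangent_structure_scheme \<Rightarrow> 'm \<Rightarrow> 'm \<Rightarrow> 'm differential_bundle \<Rightarrow> 'm \<Rightarrow> 'm \<Rightarrow> bool" where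
  "induces_horizontal X q tF F \<psi> H \<longleftrightarrow>
     (let E = Dom X q in
        (F, H, tangent_bundle X E) \<in> Arr (DB X E) \<and>
        horizontal_descent X q tF F \<cdot>\<^bsub>X\<^esub> H = \<psi> \<and> bzero F \<cdot>\<^bsub>X\<^esub> H = tzero X E)"

definition forms_of_connection ::
    "('o, 'm, 'x) tangent_structure_scheme \<Rightarrow> 'm \<Rightarrow> 'm \<Rightarrow> 'm \<Rightarrow> 'm differential_bundle \<Rightarrow>
     'm \<times> 'm \<Rightarrow> 'm \<times> 'm" where
  "forms_of_connection X q \<iota> tF F = (\<lambda>(R, H). (R \<cdot>\<^bsub>X\<^esub> \<iota>, horizontal_descent X q tF F \<cdot>\<^bsub>X\<^esub> H))"

definition connection_of_forms ::
    "('o, 'm, 'x) tangent_structure_scheme \<Rightarrow> 'm \<Rightarrow> 'm \<Rightarrow> 'm differential_bundle \<Rightarrow>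
     'm \<Rightarrow> 'm differential_bundle \<Rightarrow> 'm \<times> 'm \<Rightarrow> 'm \<times> 'm" where
  "connection_of_forms X q \<iota> V tF F =
     (\<lambda>(\<phi>, \<psi>). (THE R. induces_vertical X q \<iota> V \<phi> R, THE H. induces_horizontal X q tF F \<psi> H))"

end

theory Submission
  imports Defs
begin

text \<open>A projector splits as an epimorphism followed by a monomorphism, and a connection is such a
splitting.  A vertical form \<open>\<phi>\<close> and a horizontal form \<open>\<psi>\<close> are complementary idempotents of the
tangent bundle \<open>TE\<close>, and the two maps \<open>\<iota> : V \<rightarrow> TE\<close> and \<open>\<pi> : TE \<rightarrow> F\<close> behave like a kernel and a
cokernel: \<open>\<phi>\<close> factors uniquely as \<open>R \<iota>\<close> and \<open>\<psi>\<close> uniquely as \<open>\<pi> H\<close>.  Reading the axioms of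
forms through these factorizations, with \<open>\<iota>\<close> cancelled on the right and \<open>\<pi>\<close> on the left, gives
exactly the axioms of connections.

The two factorizations have different sources.  The vertical bundle is a pullback of \<open>T q\<close> along
the zero section of the base, and the condition on \<open>\<phi> T q\<close> says that \<open>\<phi>\<close> lands in it
(\<open>induces_vertical_exists\<close>).  Both \<open>\<iota>\<close> and \<open>T \<iota>\<close> are monic because the zero section is
split, by the projection (\<open>iota_mono\<close>, \<open>T_iota_mono\<close>); hence \<open>R\<close> is unique and inherits
linearity from \<open>\<phi>\<close>.  Dually, \<open>F\<close> is a pushout because \<open>q\<close> is a submersion, and the condition
\<open>\<iota> \<psi> = q\<^sup>V z\<^sub>E\<close> is the cocone condition on \<open>\<psi>\<close> and the zero section
(\<open>induces_horizontal_exists\<close>).  Since linear maps over a fixed base preserve zero sections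
(\<open>linear_preserves_zero\<close>), all linear maps from \<open>F\<close> to a given bundle agree on the second leg
of the pushout, so \<open>\<pi>\<close> alone is epic in \<open>DB(E)\<close> (\<open>descent_epi\<close>).

The identity \<open>H R = q\<^sup>F z\<^sup>V\<close> is the least formal one: both sides are linear, so it may be tested
after composing with \<open>\<pi>\<close> on the left and \<open>\<iota>\<close> on the right, where it becomes the given
\<open>\<psi> \<phi> = p\<^sub>E z\<^sub>E\<close>.\<close>

section \<open>Categories with a tangent structure\<close>

locale tangent_category =
  fixes X :: "('o, 'm, 'x) tangent_structure_scheme" (structure)
  assumes tangent_category: "is_tangent_category X"
begin

lemma category: "is_category X" and endofunctor: "is_endofunctor X"
  using tangent_category by (simp_all add: is_tangent_category_def)

lemma arr_obj [simp]:
  assumes "f \<in> Arr X"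
  shows "Dom X f \<in> Obj X" "Cod X f \<in> Obj X"
  using category assms by (simp_all add: is_category_def)

lemma ide_arr [simp]:
  assumes "A \<in> Obj X"
  shows "Ide X A \<in> Arr X" "Dom X (Ide X A) = A" "Cod X (Ide X A) = A"
  using category assms by (auto simp: is_category_def hom_def)

lemma comp_arr [simp]:
  assumes "f \<in> Arr X" "g \<in> Arr X" "Cod X f = Dom X g"
  shows "f \<cdot> g \<in> Arr X" "Dom X (f \<cdot> g) = Dom X f" "Cod X (f \<cdot> g) = Cod X g"
  using category assms unfolding is_category_def hom_def by blast+

lemma comp_assoc:
  assumes "f \<in> Arr X" "g \<in> Arr X" "h \<in> Arr X" "Cod X f = Dom X g" "Cod X g = Dom X h"
  shows "f \<cdot> g \<cdot> h = f \<cdot> (g \<cdot> h)"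
  using category assms unfolding is_category_def by blast

lemma comp_ide [simp]:
  assumes "f \<in> Arr X"
  shows "Dom X f = A \<Longrightarrow> Ide X A \<cdot> f = f" "Cod X f = A \<Longrightarrow> f \<cdot> Ide X A = f"
  using category assms unfolding is_category_def by blast+

lemma T_arr [simp]:
  assumes "f \<in> Arr X"
  shows "Tarr X f \<in> Arr X" "Dom X (Tarr X f) = Tobj X (Dom X f)"
    "Cod X (Tarr X f) = Tobj X (Cod X f)"
  using endofunctor assms by (auto simp: is_endofunctor_def hom_def)

lemma T_comp:
  assumes "f \<in> Arr X" "g \<in> Arr X" "Cod X f = Dom X g"
  shows "Tarr X (f \<cdot> g) = Tarr X f \<cdot> Tarr X g"
  using endofunctor assms unfolding is_endofunctor_def by blast

lemma T_ide [simp]: "A \<in> Obj X \<Longrightarrow> Tarr X (Ide X A) = Ide X (Tobj X A)"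
  and T_obj [simp]: "A \<in> Obj X \<Longrightarrow> Tobj X A \<in> Obj X"
  using endofunctor by (simp_all add: is_endofunctor_def)

lemma proj_zero_arr [simp]:
  assumes "M \<in> Obj X"
  shows "tproj X M \<in> Arr X" "Dom X (tproj X M) = Tobj X M" "Cod X (tproj X M) = M"
    "tzero X M \<in> Arr X" "Dom X (tzero X M) = M" "Cod X (tzero X M) = Tobj X M"
    "tlift X M \<in> Arr X" "Dom X (tlift X M) = Tobj X M" "Cod X (tlift X M) = Tobj X (Tobj X M)"
  using tangent_category assms by (auto simp: is_tangent_category_def hom_def)

lemma proj_natural:
  assumes "f \<in> Arr X"
  shows "Tarr X f \<cdot> tproj X (Cod X f) = tproj X (Dom X f) \<cdot> f"
  using tangent_category assms unfolding is_tangent_category_def by blast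

lemma zero_proj [simp]:
  assumes "M \<in> Obj X"
  shows "tzero X M \<cdot> tproj X M = Ide X M"
proof -
  have "is_additive_bundle X (tangent_bundle X M)"
    using tangent_category assms unfolding is_tangent_category_def by blast
  then show ?thesis
    using assms by (simp add: is_additive_bundle_def tangent_bundle_def Let_def)
qed

text \<open>A section \<open>g\<close> is monic, and pullbacks of monomorphisms are monic.  The retraction \<open>r\<close>
expresses \<open>v\<close> as \<open>u f r\<close>, so agreement on \<open>u\<close> forces agreement on \<open>v\<close>.  Being equational, the
hypothesis on \<open>g\<close> survives \<open>T\<close>, which plain monicity of \<open>g\<close> need not.\<close>

lemma split_mono_pullback:
  assumes pb: "is_pullback X f g u v"
    and r: "r \<in> Arr X" "Dom X r = Cod X g" "g \<cdot> r = Ide X (Dom X g)"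
    and h: "h \<in> Arr X" "Cod X h = Dom X u" and k: "k \<in> Arr X" "Cod X k = Dom X u"
    and eq: "h \<cdot> u = k \<cdot> u"
  shows "h = k"
proof -
  have ar: "f \<in> Arr X" "g \<in> Arr X" "u \<in> Arr X" "v \<in> Arr X" "Cod X f = Cod X g"
    "Dom X v = Dom X u" "Cod X u = Dom X f" "Cod X v = Dom X g" and sq: "u \<cdot> f = v \<cdot> g"
    using pb by (auto simp: is_pullback_def)
  have "v = v \<cdot> (g \<cdot> r)" using ar r by simp
  also have "\<dots> = v \<cdot> g \<cdot> r" using ar r(1,2) by (simp add: comp_assoc)
  also have "\<dots> = u \<cdot> (f \<cdot> r)" using ar r(1,2) by (simp add: comp_assoc flip: sq)
  finally have v: "v = u \<cdot> (f \<cdot> r)" .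
  have dom: "Dom X k = Dom X h"
    using eq h k ar by (metis comp_arr(2))
  have eqv: "h \<cdot> v = k \<cdot> v"
    using eq h k ar r by (subst (1 2) v) (simp flip: comp_assoc)
  have "\<exists>!l. l \<in> hom X (Dom X h) (Dom X u) \<and> l \<cdot> u = h \<cdot> u \<and> l \<cdot> v = h \<cdot> v"
  proof -
    have "h \<cdot> u \<in> hom X (Dom X h) (Dom X f)" "h \<cdot> v \<in> hom X (Dom X h) (Dom X g)"
      using h ar by (simp_all add: hom_def)
    moreover have "h \<cdot> u \<cdot> f = h \<cdot> v \<cdot> g"
      using h ar sq by (simp add: comp_assoc)
    ultimately show ?thesis using pb unfolding is_pullback_def by blast
  qed
  then show "h = k"
    using h k dom eq eqv by (auto simp: hom_def)
qed

lemma pair_properties: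
  assumes "is_pullback X f g u v"
    and "a \<in> hom X A (Dom X f)" "b \<in> hom X A (Dom X g)" "a \<cdot> f = b \<cdot> g"
  shows "pair X u v a b \<in> hom X A (Dom X u)" "pair X u v a b \<cdot> u = a" "pair X u v a b \<cdot> v = b"
proof -
  have "Dom X a = A"
    using assms(2) by (simp add: hom_def)
  moreover have "\<exists>!h. h \<in> hom X A (Dom X u) \<and> h \<cdot> u = a \<and> h \<cdot> v = b"
    using assms unfolding is_pullback_def by blast
  ultimately have "\<exists>!h. h \<in> hom X (Dom X a) (Dom X u) \<and> h \<cdot> u = a \<and> h \<cdot> v = b"
    by simp
  from theI'[OF this] show "pair X u v a b \<in> hom X A (Dom X u)" "pair X u v a b \<cdot> u = a"
    "pair X u v a b \<cdot> v = b"
    using assms(2) by (simp_all add: pair_def hom_def)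
qed

text \<open>The instances \<open>m = 0\<close> and \<open>m = 1\<close>: the first for maps into a bundle, the second for
comparing their lifts.\<close>

lemma tangent_pullback_powers:
  assumes "is_tangent_pullback X f g u v"
  shows "is_pullback X f g u v"
    and "is_pullback X (Tarr X f) (Tarr X g) (Tarr X u) (Tarr X v)"
  using assms[unfolded is_tangent_pullback_def, rule_format, of 0]
    assms[unfolded is_tangent_pullback_def, rule_format, of 1] by simp_all

section \<open>Linear morphisms over a fixed base\<close>

lemma differential_bundle_arr:
  assumes "is_differential_bundle X B"
  shows "bproj B \<in> Arr X" "bzero B \<in> Arr X" "Dom X (bzero B) = bbase X B"
    "Cod X (bzero B) = btot X B" "blift B \<in> Arr X" "Dom X (blift B) = btot X B"
    "Cod X (blift B) = Tobj X (btot X B)"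
  using assms
  by (auto simp: is_differential_bundle_def is_tangent_display_map_def is_additive_bundle_def
      is_additive_bundle_morphism_def tangent_bundle_def hom_def Let_def)

lemma differential_bundle_laws:
  assumes "is_differential_bundle X B"
  shows "bzero B \<cdot> bproj B = Ide X (bbase X B)"
    and "blift B \<cdot> tproj X (btot X B) = bproj B \<cdot> bzero B"
    and "bzero B \<cdot> blift B = tzero X (bbase X B) \<cdot> Tarr X (bzero B)"
  using assms
  by (auto simp: is_differential_bundle_def is_additive_bundle_def is_additive_bundle_morphism_def
      tangent_bundle_def T_bundle_def Let_def)

lemma DB_arr_iff:
  "(B, f, B') \<in> Arr (DB X E) \<longleftrightarrow>
     is_differential_bundle X B \<and> bbase X B = E \<and> is_differential_bundle X B' \<and>
     bbase X B' = E \<and> is_linear_morphism X B B' (Ide X E) f"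
  by (simp add: DB_def)

lemma DB_simps [simp]:
  "Dom (DB X E) (B, f, B') = B" "Cod (DB X E) (B, f, B') = B'"
  "(B, f, B') \<cdot>\<^bsub>DB X E\<^esub> (B1, g, B2) = (B, f \<cdot> g, B2)"
  by (simp_all add: DB_def)

lemma DB_arrD:
  assumes "(B, f, B') \<in> Arr (DB X E)"
  shows "f \<in> Arr X" "Dom X f = btot X B" "Cod X f = btot X B'" "f \<cdot> bproj B' = bproj B"
    "f \<cdot> blift B' = blift B \<cdot> Tarr X f"
  using assms differential_bundle_arr(1)[of B]
  by (auto simp: DB_arr_iff is_linear_morphism_def hom_def)

lemma DB_arrI:
  assumes "is_differential_bundle X B" "bbase X B = E" "is_differential_bundle X B'" "bbase X B' = E"
    and "f \<in> Arr X" "Dom X f = btot X B" "Cod X f = btot X B'" "f \<cdot> bproj B' = bproj B"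
    "f \<cdot> blift B' = blift B \<cdot> Tarr X f"
  shows "(B, f, B') \<in> Arr (DB X E)"
  using assms differential_bundle_arr(1)[of B] differential_bundle_arr(1)[of B']
  by (auto simp: DB_arr_iff is_linear_morphism_def hom_def)

lemma DB_comp:
  assumes "(A, f, B) \<in> Arr (DB X E)" "(B, g, C) \<in> Arr (DB X E)"
  shows "(A, f \<cdot> g, C) \<in> Arr (DB X E)"
proof (rule DB_arrI)
  note f = DB_arrD[OF assms(1)] and g = DB_arrD[OF assms(2)]
  have db: "is_differential_bundle X A" "is_differential_bundle X B" "is_differential_bundle X C"
    "bbase X A = E" "bbase X C = E"
    using assms by (simp_all add: DB_arr_iff)
  note ar = differential_bundle_arr[OF db(1)] differential_bundle_arr[OF db(2)]
    differential_bundle_arr[OF db(3)]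
  show "f \<cdot> g \<cdot> bproj C = bproj A"
    using f g ar by (simp add: comp_assoc)
  have "f \<cdot> g \<cdot> blift C = f \<cdot> (blift B \<cdot> Tarr X g)"
    using f g ar by (simp add: comp_assoc)
  also have "\<dots> = blift A \<cdot> Tarr X f \<cdot> Tarr X g"
    using f g ar by (simp flip: comp_assoc)
  finally show "f \<cdot> g \<cdot> blift C = blift A \<cdot> Tarr X (f \<cdot> g)"
    using f g ar by (simp add: comp_assoc T_comp)
qed (use assms DB_arrD[OF assms(1)] DB_arrD[OF assms(2)] in \<open>simp_all add: DB_arr_iff\<close>)

lemma DB_ide:
  assumes "is_differential_bundle X B" "bbase X B = E"
  shows "(B, Ide X (btot X B), B) \<in> Arr (DB X E)"
  using assms differential_bundle_arr[OF assms(1)] by (intro DB_arrI) simp_all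

text \<open>Zero sections can be recovered from lifts, since \<open>l\<close> followed by the tangent projection is
\<open>q z\<close>.  A linear map commutes with lifts, and by naturality with tangent projections, so
\<open>q z f = f q' z' = q z'\<close>; precomposing with the section \<open>z\<close> of \<open>q\<close> removes \<open>q\<close>.\<close>

lemma linear_preserves_zero:
  assumes "(B, f, B') \<in> Arr (DB X E)"
  shows "bzero B \<cdot> f = bzero B'"
proof -
  have db: "is_differential_bundle X B" "is_differential_bundle X B'" "bbase X B = E" "bbase X B' = E"
    using assms by (simp_all add: DB_arr_iff)
  note f = DB_arrD[OF assms]
  note ar = differential_bundle_arr[OF db(1)] differential_bundle_arr[OF db(2)]
  note laws = differential_bundle_laws[OF db(1)] differential_bundle_laws[OF db(2)]
  have "bproj B \<cdot> (bzero B \<cdot> f) = blift B \<cdot> (tproj X (btot X B) \<cdot> f)"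
    using f ar laws by (simp flip: comp_assoc)
  also have "\<dots> = blift B \<cdot> (Tarr X f \<cdot> tproj X (btot X B'))"
    using f proj_natural[of f] by simp
  also have "\<dots> = f \<cdot> (blift B' \<cdot> tproj X (btot X B'))"
    using f ar by (simp flip: comp_assoc)
  also have "\<dots> = bproj B \<cdot> bzero B'"
    using f ar laws db by (simp flip: comp_assoc)
  finally have eq: "bproj B \<cdot> (bzero B \<cdot> f) = bproj B \<cdot> bzero B'" .
  have "bzero B \<cdot> f = bzero B \<cdot> bproj B \<cdot> (bzero B \<cdot> f)"
    using f ar laws db by simp
  also have "\<dots> = bzero B \<cdot> bproj B \<cdot> bzero B'"
    using f ar db eq by (simp add: comp_assoc)
  finally show ?thesis
    using ar laws db by simp
qed

text \<open>Linearity is the zero part of the additivity of the lift, \<open>z l = z\<^sub>M T z\<close>, read as a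
statement about the trivial bundle.\<close>

lemma zero_section_DB:
  assumes "is_differential_bundle X B" "bbase X B = E" "is_differential_bundle X (trivial_bundle X E)"
  shows "(trivial_bundle X E, bzero B, B) \<in> Arr (DB X E)"
  using assms differential_bundle_arr[OF assms(1)] differential_bundle_laws[OF assms(1)]
  by (intro DB_arrI) (auto simp: trivial_bundle_def)

text \<open>Linearity here says that the lift covers the zero section of the base.\<close>

lemma bundle_projection_DB:
  assumes "is_differential_bundle X B" "bbase X B = E" "is_differential_bundle X (trivial_bundle X E)"
  shows "(B, bproj B, trivial_bundle X E) \<in> Arr (DB X E)"
proof -
  have "bproj B \<cdot> tzero X E = blift B \<cdot> Tarr X (bproj B)"
    using assms(1,2)
    by (auto simp: is_differential_bundle_def is_additive_bundle_morphism_def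
        T_bundle_def Let_def)
  then show ?thesis
    using assms differential_bundle_arr[OF assms(1)]
    by (intro DB_arrI) (auto simp: trivial_bundle_def)
qed

end

section \<open>The vertical and the Finsler bundle of a submersion\<close>

locale submersion = tangent_category X
  for X :: "('o, 'm, 'x) tangent_structure_scheme" (structure) +
  fixes q \<iota> tV tF :: 'm and V F :: "'m differential_bundle"
  assumes vertical: "is_vertical_bundle X q \<iota> tV V"
    and submersion: "is_submersion X q \<iota> V tF F"
begin

abbreviation "E \<equiv> Dom X q"
abbreviation "M \<equiv> Cod X q"
abbreviation "TE \<equiv> tangent_bundle X E"
abbreviation "OE \<equiv> trivial_bundle X E"
abbreviation "\<pi> \<equiv> horizontal_descent X q tF F"

lemma q_arr [simp]: "q \<in> Arr X"
  using submersion by (simp add: is_submersion_def is_tangent_display_map_def)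

lemma pushout:
  "is_pushout (DB X E) (V, \<iota>, TE) (V, bproj V, OE) (TE, \<pi>, F) (OE, bzero F, F)"
  using submersion by (simp add: is_submersion_def Let_def)

lemma square_DB:
  "(V, \<iota>, TE) \<in> Arr (DB X E)" "(V, bproj V, OE) \<in> Arr (DB X E)"
  "(TE, \<pi>, F) \<in> Arr (DB X E)" "(OE, bzero F, F) \<in> Arr (DB X E)"
  and square: "\<iota> \<cdot> \<pi> = bproj V \<cdot> bzero F"
  using pushout by (simp_all add: is_pushout_def)

lemma pushout_universal:
  assumes "a \<in> hom (DB X E) TE B" "b \<in> hom (DB X E) OE B"
    and "(V, \<iota>, TE) \<cdot>\<^bsub>DB X E\<^esub> a = (V, bproj V, OE) \<cdot>\<^bsub>DB X E\<^esub> b"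
  shows "\<exists>!h. h \<in> hom (DB X E) F B \<and>
    (TE, \<pi>, F) \<cdot>\<^bsub>DB X E\<^esub> h = a \<and> (OE, bzero F, F) \<cdot>\<^bsub>DB X E\<^esub> h = b"
proof -
  have "\<forall>A. \<forall>a\<in>hom (DB X E) TE A. \<forall>b\<in>hom (DB X E) OE A.
      (V, \<iota>, TE) \<cdot>\<^bsub>DB X E\<^esub> a = (V, bproj V, OE) \<cdot>\<^bsub>DB X E\<^esub> b \<longrightarrow>
      (\<exists>!h. h \<in> hom (DB X E) F A \<and>
        (TE, \<pi>, F) \<cdot>\<^bsub>DB X E\<^esub> h = a \<and> (OE, bzero F, F) \<cdot>\<^bsub>DB X E\<^esub> h = b)"
    using pushout unfolding is_pushout_def DB_simps(1,2) by (elim conjE)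
  then show ?thesis using assms by blast
qed

lemma bundles:
  "is_differential_bundle X V" "bbase X V = E" "is_differential_bundle X F" "bbase X F = E"
  "is_differential_bundle X TE" "is_differential_bundle X OE"
  using square_DB by (simp_all add: DB_arr_iff)

lemma TE_simps [simp]:
  "bproj TE = tproj X E" "bzero TE = tzero X E" "blift TE = tlift X E"
  by (simp_all add: tangent_bundle_def)

lemmas V_arr [simp] = differential_bundle_arr[OF bundles(1)] bundles(2)
lemmas F_arr [simp] = differential_bundle_arr[OF bundles(3)] bundles(4)
lemmas iota_arr [simp] = DB_arrD(1-3)[OF square_DB(1), simplified]
lemmas descent_arr [simp] = DB_arrD(1-3)[OF square_DB(3), simplified]

lemma vertical_pullback: "is_tangent_pullback X (Tarr X q) (tzero X M) \<iota> tV"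
  and vertical_proj: "\<iota> \<cdot> tproj X E = bproj V"
  and vertical_zero: "bzero V \<cdot> \<iota> = tzero X E"
  and vertical_lift: "blift V \<cdot> Tarr X \<iota> = \<iota> \<cdot> tlift X E"
  using vertical by (simp_all add: is_vertical_bundle_def Let_def)

text \<open>The zero section of \<open>M\<close>, along which \<open>\<iota>\<close> is pulled back, is split by the tangent projection.\<close>

lemma iota_mono:
  assumes "h \<in> Arr X" "Cod X h = btot X V" "k \<in> Arr X" "Cod X k = btot X V" "h \<cdot> \<iota> = k \<cdot> \<iota>"
  shows "h = k"
  using split_mono_pullback[OF tangent_pullback_powers(1)[OF vertical_pullback],
      of "tproj X M" h k] assms
  by simp

lemma T_iota_mono:
  assumes "h \<in> Arr X" "Cod X h = Tobj X (btot X V)" "k \<in> Arr X" "Cod X k = Tobj X (btot X V)"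
    and "h \<cdot> Tarr X \<iota> = k \<cdot> Tarr X \<iota>"
  shows "h = k"
  using split_mono_pullback[OF tangent_pullback_powers(2)[OF vertical_pullback],
      of "Tarr X (tproj X M)" h k] assms
  by (simp flip: T_comp)

text \<open>Composing the pullback square that defines \<open>V\<close> with the tangent projection of \<open>M\<close> removes the
zero section and leaves \<open>tV\<close> on one side.\<close>

lemma vertical_to_base: "tV = bproj V \<cdot> q"
proof -
  have pb: "is_pullback X (Tarr X q) (tzero X M) \<iota> tV"
    by (rule tangent_pullback_powers[OF vertical_pullback])
  then have tV: "tV \<in> Arr X" "Cod X tV = M" "\<iota> \<cdot> Tarr X q = tV \<cdot> tzero X M"
    by (auto simp: is_pullback_def)
  have "tV = tV \<cdot> tzero X M \<cdot> tproj X M"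
    using tV by (simp add: comp_assoc)
  also have "\<dots> = \<iota> \<cdot> (Tarr X q \<cdot> tproj X M)"
    by (simp add: comp_assoc flip: tV(3))
  also have "\<dots> = \<iota> \<cdot> tproj X E \<cdot> q"
    by (simp add: comp_assoc proj_natural)
  finally show ?thesis
    by (simp add: vertical_proj)
qed

lemma descent_proj: "\<pi> \<cdot> bproj F = tproj X E"
  using DB_arrD(4)[OF square_DB(3)] by simp

text \<open>The pushout makes \<open>\<pi>\<close> and the zero section of \<open>F\<close> jointly epic among linear maps, and on the
zero section all linear maps to a given bundle agree.\<close>

lemma descent_epi:
  assumes "(F, h, B) \<in> Arr (DB X E)" "(F, k, B) \<in> Arr (DB X E)" "\<pi> \<cdot> h = \<pi> \<cdot> k"
  shows "h = k"
proof -
  have mk: "(TE, \<pi> \<cdot> k, B) \<in> Arr (DB X E)" "(OE, bzero F \<cdot> k, B) \<in> Arr (DB X E)"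
    using DB_comp square_DB assms(2) by blast+
  have zero: "bzero F \<cdot> h = bzero F \<cdot> k"
    using assms(1,2) by (simp add: linear_preserves_zero)
  have "\<iota> \<cdot> (\<pi> \<cdot> k) = bproj V \<cdot> (bzero F \<cdot> k)"
    using DB_arrD[OF assms(2)] square by (simp flip: comp_assoc)
  moreover have "(TE, \<pi> \<cdot> k, B) \<in> hom (DB X E) TE B" "(OE, bzero F \<cdot> k, B) \<in> hom (DB X E) OE B"
    using mk by (simp_all add: hom_def)
  ultimately have "\<exists>!h. h \<in> hom (DB X E) F B \<and>
      (TE, \<pi>, F) \<cdot>\<^bsub>DB X E\<^esub> h = (TE, \<pi> \<cdot> k, B) \<and>
      (OE, bzero F, F) \<cdot>\<^bsub>DB X E\<^esub> h = (OE, bzero F \<cdot> k, B)"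
    by (intro pushout_universal) simp_all
  moreover have "(F, h, B) \<in> hom (DB X E) F B" "(F, k, B) \<in> hom (DB X E) F B"
    using assms by (simp_all add: hom_def)
  ultimately have "(F, h, B) = (F, k, B)"
    using zero assms(3) by (metis DB_simps(3))
  then show ?thesis by simp
qed

text \<open>A cokernel property: linear maps out of the tangent bundle that vanish on vertical vectors
descend to the Finsler bundle.  The other leg of the cocone is the zero section of the target.\<close>

lemma descent_factor:
  assumes f: "(TE, f, B) \<in> Arr (DB X E)" and vanish: "\<iota> \<cdot> f = bproj V \<cdot> bzero B"
  obtains h where "(F, h, B) \<in> Arr (DB X E)" "\<pi> \<cdot> h = f"
proof -
  have B: "is_differential_bundle X B" "bbase X B = E"
    using f by (simp_all add: DB_arr_iff)
  have "(TE, f, B) \<in> hom (DB X E) TE B" "(OE, bzero B, B) \<in> hom (DB X E) OE B"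
    using f zero_section_DB[OF B bundles(6)] by (simp_all add: hom_def)
  then have "\<exists>!h. h \<in> hom (DB X E) F B \<and> (TE, \<pi>, F) \<cdot>\<^bsub>DB X E\<^esub> h = (TE, f, B) \<and>
      (OE, bzero F, F) \<cdot>\<^bsub>DB X E\<^esub> h = (OE, bzero B, B)"
    using vanish by (intro pushout_universal) simp_all
  then obtain h where "h \<in> hom (DB X E) F B" "(TE, \<pi>, F) \<cdot>\<^bsub>DB X E\<^esub> h = (TE, f, B)"
    by blast
  then show thesis
    by (cases h) (auto simp: hom_def intro: that)
qed

section \<open>Connections and connection forms\<close>

lemma linear_morphism_DB:
  assumes "is_differential_bundle X B" "bbase X B = E" "is_differential_bundle X B'" "bbase X B' = E"
  shows "is_linear_morphism X B B' (Ide X E) f \<longleftrightarrow> (B, f, B') \<in> Arr (DB X E)"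
  using assms by (simp add: DB_arr_iff)

lemma base_TE: "bbase X TE = E"
  by simp

lemma Ehresmann_connections_iff:
  "(R, H) \<in> Ehresmann_connections X q \<iota> V tF F \<longleftrightarrow>
     (TE, R, V) \<in> Arr (DB X E) \<and> \<iota> \<cdot> R = Ide X (btot X V) \<and>
     (F, H, TE) \<in> Arr (DB X E) \<and> H \<cdot> \<pi> = Ide X (btot X F) \<and>
     H \<cdot> R = bproj F \<cdot> bzero V \<and>
     tpair X E (R \<cdot> \<iota>) (\<pi> \<cdot> H) \<cdot> tsum X E = Ide X (Tobj X E)"
  by (simp add: Ehresmann_connections_def is_vertical_connection_def is_horizontal_connection_def
      Let_def linear_morphism_DB[OF bundles(5) base_TE bundles(1,2)]
      linear_morphism_DB[OF bundles(3,4) bundles(5) base_TE])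

lemma Ehresmann_connection_forms_iff:
  "(\<phi>, \<psi>) \<in> Ehresmann_connection_forms X q \<iota> V tF F \<longleftrightarrow>
     (TE, \<phi>, TE) \<in> Arr (DB X E) \<and> \<iota> \<cdot> \<phi> = \<iota> \<and> \<phi> \<cdot> Tarr X q = tproj X E \<cdot> q \<cdot> tzero X M \<and>
     (TE, \<psi>, TE) \<in> Arr (DB X E) \<and> \<psi> \<cdot> \<pi> = \<pi> \<and> \<iota> \<cdot> \<psi> = bproj V \<cdot> tzero X E \<and>
     \<psi> \<cdot> \<phi> = tproj X E \<cdot> tzero X E \<and>
     tpair X E \<phi> \<psi> \<cdot> tsum X E = Ide X (Tobj X E)"
  by (simp add: Ehresmann_connection_forms_def is_vertical_connection_form_def
      is_horizontal_connection_form_def Let_def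
      linear_morphism_DB[OF bundles(5) base_TE bundles(5) base_TE])

text \<open>The condition \<open>R q\<^sup>V = p\<^sub>E\<close> is part of being an arrow over \<open>E\<close>.\<close>

lemma induces_vertical_iff:
  "induces_vertical X q \<iota> V \<phi> R \<longleftrightarrow> (TE, R, V) \<in> Arr (DB X E) \<and> R \<cdot> \<iota> = \<phi>"
  using DB_arrD(4)[of TE R V E] by (auto simp: induces_vertical_def Let_def)

text \<open>Linear maps preserve zero, which gives \<open>z\<^sup>F H = z\<^sub>E\<close>.\<close>

lemma induces_horizontal_iff:
  "induces_horizontal X q tF F \<psi> H \<longleftrightarrow> (F, H, TE) \<in> Arr (DB X E) \<and> \<pi> \<cdot> H = \<psi>"
  using linear_preserves_zero[of F H TE E] by (auto simp: induces_horizontal_def Let_def)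

lemma induces_vertical_unique:
  assumes "induces_vertical X q \<iota> V \<phi> R" "induces_vertical X q \<iota> V \<phi> R'"
  shows "R = R'"
proof (rule iota_mono)
  have R: "(TE, R, V) \<in> Arr (DB X E)" "(TE, R', V) \<in> Arr (DB X E)"
    and eq: "R \<cdot> \<iota> = \<phi>" "R' \<cdot> \<iota> = \<phi>"
    using assms by (simp_all add: induces_vertical_iff)
  show "R \<in> Arr X" "Cod X R = btot X V" "R' \<in> Arr X" "Cod X R' = btot X V"
    by (rule DB_arrD[OF R(1)] DB_arrD[OF R(2)])+
  show "R \<cdot> \<iota> = R' \<cdot> \<iota>"
    by (simp add: eq)
qed

lemma induces_horizontal_unique:
  assumes "induces_horizontal X q tF F \<psi> H" "induces_horizontal X q tF F \<psi> H'"
  shows "H = H'"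
  using assms unfolding induces_horizontal_iff by (metis descent_epi)

text \<open>That \<open>R \<iota>\<close> fixes \<open>\<iota>\<close> and \<open>\<pi> H\<close> fixes \<open>\<pi>\<close> follows by cancelling \<open>\<iota> R\<close> and \<open>H \<pi>\<close>.  The two
degeneracy conditions use more: \<open>R \<iota> T q\<close> is computed with the vertical pullback square, and
\<open>\<iota> \<pi> H\<close> with the square that defines a submersion and the fact that \<open>H\<close> preserves zero.\<close>

lemma forms_of_Ehresmann_connection:
  assumes "(R, H) \<in> Ehresmann_connections X q \<iota> V tF F"
  shows "(R \<cdot> \<iota>, \<pi> \<cdot> H) \<in> Ehresmann_connection_forms X q \<iota> V tF F"
proof -
  have R: "(TE, R, V) \<in> Arr (DB X E)" "\<iota> \<cdot> R = Ide X (btot X V)"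
    and H: "(F, H, TE) \<in> Arr (DB X E)" "H \<cdot> \<pi> = Ide X (btot X F)"
    and RH: "H \<cdot> R = bproj F \<cdot> bzero V"
      "tpair X E (R \<cdot> \<iota>) (\<pi> \<cdot> H) \<cdot> tsum X E = Ide X (Tobj X E)"
    using assms by (simp_all add: Ehresmann_connections_iff)
  note R' [simp] = DB_arrD(1-3)[OF R(1), simplified] and H' [simp] = DB_arrD(1-3)[OF H(1), simplified]
  have "is_pullback X (Tarr X q) (tzero X M) \<iota> tV"
    by (rule tangent_pullback_powers[OF vertical_pullback])
  then have "\<iota> \<cdot> Tarr X q = bproj V \<cdot> q \<cdot> tzero X M"
    by (simp add: is_pullback_def vertical_to_base)
  then have "R \<cdot> \<iota> \<cdot> Tarr X q = R \<cdot> bproj V \<cdot> (q \<cdot> tzero X M)"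
    by (simp add: comp_assoc)
  then have vert: "R \<cdot> \<iota> \<cdot> Tarr X q = tproj X E \<cdot> q \<cdot> tzero X M"
    using DB_arrD(4)[OF R(1)] by (simp add: comp_assoc)
  have "\<iota> \<cdot> (\<pi> \<cdot> H) = bproj V \<cdot> (bzero F \<cdot> H)"
    using square by (simp flip: comp_assoc)
  also have "\<dots> = bproj V \<cdot> tzero X E"
    using linear_preserves_zero[OF H(1)] by simp
  finally have horiz: "\<iota> \<cdot> (\<pi> \<cdot> H) = bproj V \<cdot> tzero X E" .
  have "\<pi> \<cdot> H \<cdot> (R \<cdot> \<iota>) = \<pi> \<cdot> (H \<cdot> R \<cdot> \<iota>)"
    by (simp add: comp_assoc)
  also have "\<dots> = \<pi> \<cdot> bproj F \<cdot> (bzero V \<cdot> \<iota>)"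
    by (simp add: RH comp_assoc)
  also have "\<dots> = tproj X E \<cdot> tzero X E"
    by (simp add: descent_proj vertical_zero)
  finally have orth: "\<pi> \<cdot> H \<cdot> (R \<cdot> \<iota>) = tproj X E \<cdot> tzero X E" .
  have "\<iota> \<cdot> (R \<cdot> \<iota>) = \<iota>" "\<pi> \<cdot> H \<cdot> \<pi> = \<pi>"
    using R(2) H(2) by (simp add: comp_assoc[symmetric], simp add: comp_assoc)
  with vert horiz orth RH(2) show ?thesis
    by (simp add: Ehresmann_connection_forms_iff DB_comp[OF R(1) square_DB(1)]
        DB_comp[OF square_DB(3) H(1)])
qed

text \<open>The condition on \<open>\<phi> T q\<close> is the compatibility needed to pair \<open>\<phi>\<close> with \<open>p\<^sub>E q\<close> into the vertical
pullback.  Linearity of the result is tested after composing with the monomorphism \<open>T \<iota>\<close>, where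
it reduces to linearity of \<open>\<phi>\<close>.\<close>

lemma induces_vertical_exists:
  assumes phi: "(TE, \<phi>, TE) \<in> Arr (DB X E)"
    and vert: "\<phi> \<cdot> Tarr X q = tproj X E \<cdot> q \<cdot> tzero X M"
  shows "\<exists>R. induces_vertical X q \<iota> V \<phi> R"
proof -
  note phi' [simp] = DB_arrD(1-3)[OF phi, simplified]
  define R where "R = pair X \<iota> tV \<phi> (tproj X E \<cdot> q)"
  have "R \<in> hom X (Tobj X E) (Dom X \<iota>)" "R \<cdot> \<iota> = \<phi>"
    using pair_properties[OF tangent_pullback_powers(1)[OF vertical_pullback],
        of \<phi> "Tobj X E" "tproj X E \<cdot> q"] vert
    by (simp_all add: R_def hom_def)
  then have R [simp]: "R \<in> Arr X" "Dom X R = Tobj X E" "Cod X R = btot X V"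
    and fac: "R \<cdot> \<iota> = \<phi>"
    by (simp_all add: hom_def)
  have proj: "R \<cdot> bproj V = tproj X E"
  proof -
    have "R \<cdot> bproj V = R \<cdot> \<iota> \<cdot> tproj X E"
      by (simp add: comp_assoc vertical_proj)
    then show ?thesis
      using DB_arrD(4)[OF phi] by (simp add: fac)
  qed
  have lift: "R \<cdot> blift V = tlift X E \<cdot> Tarr X R"
  proof (rule T_iota_mono)
    have "R \<cdot> blift V \<cdot> Tarr X \<iota> = R \<cdot> \<iota> \<cdot> tlift X E"
      by (simp add: comp_assoc vertical_lift)
    also have "\<dots> = tlift X E \<cdot> Tarr X (R \<cdot> \<iota>)"
      using DB_arrD(5)[OF phi] by (simp add: fac)
    finally show "R \<cdot> blift V \<cdot> Tarr X \<iota> = tlift X E \<cdot> Tarr X R \<cdot> Tarr X \<iota>"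
      by (simp add: T_comp comp_assoc)
  qed simp_all
  have "(TE, R, V) \<in> Arr (DB X E)"
    using proj lift bundles by (intro DB_arrI) simp_all
  with fac show ?thesis
    by (auto simp: induces_vertical_iff)
qed

lemma induces_horizontal_exists:
  assumes "(TE, \<psi>, TE) \<in> Arr (DB X E)" "\<iota> \<cdot> \<psi> = bproj V \<cdot> tzero X E"
  shows "\<exists>H. induces_horizontal X q tF F \<psi> H"
proof -
  obtain H where "(F, H, TE) \<in> Arr (DB X E)" "\<pi> \<cdot> H = \<psi>"
    using descent_factor[OF assms(1)] assms(2) by auto
  then show ?thesis by (auto simp: induces_horizontal_iff)
qed

text \<open>Each condition on a composite comes from the corresponding one on forms by cancellation: of the
monomorphism \<open>\<iota>\<close> for \<open>\<iota> R\<close>, of the epimorphism \<open>\<pi>\<close> for \<open>H \<pi>\<close>, and of both for \<open>H R\<close>.  Cancelling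
\<open>\<pi>\<close> requires both sides to be linear, which for the zero map \<open>q\<^sup>F z\<^sup>V\<close> holds because it factors
through the trivial bundle.\<close>

lemma Ehresmann_connection_of_forms:
  assumes "(\<phi>, \<psi>) \<in> Ehresmann_connection_forms X q \<iota> V tF F"
    and "induces_vertical X q \<iota> V \<phi> R" "induces_horizontal X q tF F \<psi> H"
  shows "(R, H) \<in> Ehresmann_connections X q \<iota> V tF F"
proof -
  have form: "\<iota> \<cdot> \<phi> = \<iota>" "\<psi> \<cdot> \<pi> = \<pi>"  "\<psi> \<cdot> \<phi> = tproj X E \<cdot> tzero X E"
     "tpair X E \<phi> \<psi> \<cdot> tsum X E = Ide X (Tobj X E)"
    using assms(1) by (simp_all add: Ehresmann_connection_forms_iff)
  have R: "(TE, R, V) \<in> Arr (DB X E)" "R \<cdot> \<iota> = \<phi>" and H: "(F, H, TE) \<in> Arr (DB X E)" "\<pi> \<cdot> H = \<psi>"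
    using assms by (simp_all add: induces_vertical_iff induces_horizontal_iff)
  note R' [simp] = DB_arrD(1-3)[OF R(1), simplified] and H' [simp] = DB_arrD(1-3)[OF H(1), simplified]
  have retraction: "\<iota> \<cdot> R = Ide X (btot X V)"
    by (rule iota_mono) (simp_all add: comp_assoc R(2) form(1))
  have "\<pi> \<cdot> (H \<cdot> \<pi>) = \<pi> \<cdot> Ide X (btot X F)"
    by (simp add: H(2) form(2) flip: comp_assoc)
  then have "section": "H \<cdot> \<pi> = Ide X (btot X F)"
    by (rule descent_epi[OF DB_comp[OF H(1) square_DB(3)] DB_ide[OF bundles(3,4)]])
  \<comment> \<open>Mixed condition: with \<open>\<pi>\<close> in front and \<open>\<iota>\<close> behind it is \<open>\<psi> \<phi> = p\<^sub>E z\<^sub>E\<close>.\<close>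
  have "\<pi> \<cdot> (H \<cdot> R) = \<pi> \<cdot> (bproj F \<cdot> bzero V)"
  proof (rule iota_mono)
    have "\<pi> \<cdot> (H \<cdot> R) \<cdot> \<iota> = \<pi> \<cdot> H \<cdot> (R \<cdot> \<iota>)"
      by (simp add: comp_assoc)
    also have "\<dots> = tproj X E \<cdot> (bzero V \<cdot> \<iota>)"
      by (simp add: R(2) H(2) form(3) vertical_zero comp_assoc)
    also have "\<dots> = \<pi> \<cdot> bproj F \<cdot> (bzero V \<cdot> \<iota>)"
      by (simp only: descent_proj)
    also have "\<dots> = \<pi> \<cdot> (bproj F \<cdot> bzero V) \<cdot> \<iota>"
      by (simp add: comp_assoc)
    finally show "\<pi> \<cdot> (H \<cdot> R) \<cdot> \<iota> = \<pi> \<cdot> (bproj F \<cdot> bzero V) \<cdot> \<iota>" .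
  qed simp_all
  then have "H \<cdot> R = bproj F \<cdot> bzero V"
    by (rule descent_epi[OF DB_comp[OF H(1) R(1)]
          DB_comp[OF bundle_projection_DB[OF bundles(3,4,6)] zero_section_DB[OF bundles(1,2,6)]]])
  with retraction "section" R H form(4) show ?thesis
    by (simp add: Ehresmann_connections_iff)
qed

lemma connection_of_forms_eq:
  assumes "induces_vertical X q \<iota> V \<phi> R" "induces_horizontal X q tF F \<psi> H"
  shows "connection_of_forms X q \<iota> V tF F (\<phi>, \<psi>) = (R, H)"
proof -
  have "(THE R. induces_vertical X q \<iota> V \<phi> R) = R"
    using assms(1) induces_vertical_unique[OF _ assms(1)] by (rule the_equality)
  moreover have "(THE H. induces_horizontal X q tF F \<psi> H) = H"
    using assms(2) induces_horizontal_unique[OF _ assms(2)] by (rule the_equality)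
  ultimately show ?thesis
    by (simp add: connection_of_forms_def)
qed

lemma forms_induce_connection:
  assumes "(\<phi>, \<psi>) \<in> Ehresmann_connection_forms X q \<iota> V tF F"
  obtains R H where "induces_vertical X q \<iota> V \<phi> R" "induces_horizontal X q tF F \<psi> H"
    "(R, H) \<in> Ehresmann_connections X q \<iota> V tF F"
    "connection_of_forms X q \<iota> V tF F (\<phi>, \<psi>) = (R, H)"
proof -
  obtain R where R: "induces_vertical X q \<iota> V \<phi> R"
    using assms induces_vertical_exists[of \<phi>] by (auto simp: Ehresmann_connection_forms_iff)
  obtain H where H: "induces_horizontal X q tF F \<psi> H"
    using assms induces_horizontal_exists[of \<psi>] by (auto simp: Ehresmann_connection_forms_iff)
  show thesis
    using R H Ehresmann_connection_of_forms[OF assms R H] connection_of_forms_eq[OF R H] by (rule that)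
qed

lemma connection_of_forms_of_connection:
  assumes "c \<in> Ehresmann_connections X q \<iota> V tF F"
  shows "connection_of_forms X q \<iota> V tF F (forms_of_connection X q \<iota> tF F c) = c"
proof (cases c)
  case (Pair R H)
  with assms have "induces_vertical X q \<iota> V (R \<cdot> \<iota>) R" "induces_horizontal X q tF F (\<pi> \<cdot> H) H"
    by (simp_all add: Ehresmann_connections_iff induces_vertical_iff induces_horizontal_iff)
  with Pair show ?thesis
    by (simp add: forms_of_connection_def connection_of_forms_eq)
qed

lemma forms_of_connection_of_forms:
  assumes "w \<in> Ehresmann_connection_forms X q \<iota> V tF F"
  shows "forms_of_connection X q \<iota> tF F (connection_of_forms X q \<iota> V tF F w) = w"
proof (cases w)
  case (Pair \<phi> \<psi>)
  with assms have "(\<phi>, \<psi>) \<in> Ehresmann_connection_forms X q \<iota> V tF F"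
    by simp
  then obtain R H where "induces_vertical X q \<iota> V \<phi> R" "induces_horizontal X q tF F \<psi> H"
    and "connection_of_forms X q \<iota> V tF F (\<phi>, \<psi>) = (R, H)"
    by (rule forms_induce_connection)
  with Pair show ?thesis
    by (simp add: forms_of_connection_def induces_vertical_iff induces_horizontal_iff)
qed

end

section \<open>The correspondence\<close>

theorem theorem3p18:
  fixes X :: "('o, 'm) tangent_structure"
    and q \<iota> tV tF :: 'm
    and V F :: "'m differential_bundle"
  assumes "is_tangent_category X"
    and "is_vertical_bundle X q \<iota> tV V"
    and "is_Finsler_bundle X q tF F"
    and "is_submersion X q \<iota> V tF F"
  shows "(\<forall>(R, H) \<in> Ehresmann_connections X q \<iota> V tF F.
            (R \<cdot>\<^bsub>X\<^esub> \<iota>, horizontal_descent X q tF F \<cdot>\<^bsub>X\<^esub> H) \<in> Ehresmann_connection_forms X q \<iota> V tF F) \<and>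
         (\<forall>(\<phi>, \<psi>) \<in> Ehresmann_connection_forms X q \<iota> V tF F.
            (\<exists>!R. induces_vertical X q \<iota> V \<phi> R) \<and>
            (\<exists>!H. induces_horizontal X q tF F \<psi> H) \<and>
            (THE R. induces_vertical X q \<iota> V \<phi> R, THE H. induces_horizontal X q tF F \<psi> H)
              \<in> Ehresmann_connections X q \<iota> V tF F) \<and>
         bij_betw (forms_of_connection X q \<iota> tF F)
           (Ehresmann_connections X q \<iota> V tF F) (Ehresmann_connection_forms X q \<iota> V tF F) \<and>
         bij_betw (connection_of_forms X q \<iota> V tF F)
           (Ehresmann_connection_forms X q \<iota> V tF F) (Ehresmann_connections X q \<iota> V tF F) \<and>
         (\<forall>c \<in> Ehresmann_connections X q \<iota> V tF F.
            connection_of_forms X q \<iota> V tF F (forms_of_connection X q \<iota> tF F c) = c) \<and>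
         (\<forall>w \<in> Ehresmann_connection_forms X q \<iota> V tF F.
            forms_of_connection X q \<iota> tF F (connection_of_forms X q \<iota> V tF F w) = w)"
proof -
  interpret submersion X q \<iota> tV tF V F
    by (intro submersion.intro tangent_category.intro submersion_axioms.intro assms)
  let ?C = "Ehresmann_connections X q \<iota> V tF F"
  let ?W = "Ehresmann_connection_forms X q \<iota> V tF F"
  let ?f = "forms_of_connection X q \<iota> tF F"
  let ?g = "connection_of_forms X q \<iota> V tF F"
  have to_forms: "?f c \<in> ?W" if "c \<in> ?C" for c
  proof (cases c)
    case (Pair R H)
    with that have "(R, H) \<in> ?C" by simp
    then show ?thesis
      by (simp only: Pair forms_of_connection_def prod.case forms_of_Ehresmann_connection)
  qed
  have to_connections: "?g w \<in> ?C" if "w \<in> ?W" for w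
  proof (cases w)
    case (Pair \<phi> \<psi>)
    with that have "(\<phi>, \<psi>) \<in> ?W" by simp
    then show ?thesis unfolding Pair by (rule forms_induce_connection) simp
  qed
  have fg: "\<forall>w\<in>?W. ?f (?g w) = w" and gf: "\<forall>c\<in>?C. ?g (?f c) = c"
    by (intro ballI forms_of_connection_of_forms connection_of_forms_of_connection; assumption)+
  have forward: "\<forall>(R, H)\<in>?C. (R \<cdot>\<^bsub>X\<^esub> \<iota>, \<pi> \<cdot>\<^bsub>X\<^esub> H) \<in> ?W"
    by (clarify, rule forms_of_Ehresmann_connection)
  have backward: "\<forall>(\<phi>, \<psi>)\<in>?W. (\<exists>!R. induces_vertical X q \<iota> V \<phi> R) \<and>
      (\<exists>!H. induces_horizontal X q tF F \<psi> H) \<and>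
      (THE R. induces_vertical X q \<iota> V \<phi> R, THE H. induces_horizontal X q tF F \<psi> H) \<in> ?C"
  proof (clarify, intro conjI)
    fix \<phi> \<psi>
    assume w: "(\<phi>, \<psi>) \<in> ?W"
    then obtain R H where "induces_vertical X q \<iota> V \<phi> R" "induces_horizontal X q tF F \<psi> H"
      by (rule forms_induce_connection)
    then show "\<exists>!R. induces_vertical X q \<iota> V \<phi> R" "\<exists>!H. induces_horizontal X q tF F \<psi> H"
      using induces_vertical_unique induces_horizontal_unique by metis+
    show "(THE R. induces_vertical X q \<iota> V \<phi> R, THE H. induces_horizontal X q tF F \<psi> H) \<in> ?C"
      using to_connections[OF w] by (simp only: connection_of_forms_def prod.case)
  qed
  have images: "?f ` ?C \<subseteq> ?W" "?g ` ?W \<subseteq> ?C"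
    by (rule image_subsetI, erule to_forms to_connections)+
  show ?thesis
    by (intro conjI forward backward fg gf bij_betw_byWitness[OF gf fg images]
        bij_betw_byWitness[OF fg gf images(2,1)])
qed

end
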